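(* Let $\mathbf{k}$ be a field of characteristic $0$ and let $(A,\mu,\alpha)$ be a multiplicative Hom-algebra over $\mathbf{k}$ that is either a right Hom-alternative algebra or a non-commutative Hom-Jordan algebra. Then $A$ is up to fourth Hom-power associative.
   Context: A Hom-algebra $(A,\mu,\alpha)$ over $\mathbf{k}$ is a $\mathbf{k}$-vector space $A$ with a bilinear map $\mu\colon A^{\otimes 2}\to A$ (no associativity assumed; write $xy=\mu(x,y)$) and a linear map $\alpha\colon A\to A$. It is multiplicative if $\alpha(xy)=\alpha(x)\alpha(y)$ for all $x,y$. Here $\alpha^n$ is the $n$-fold composition, $\alpha^0=Id$. Hom-powers: $x^1=x$ and $x^n=x^{n-1}\alpha^{n-2}(x)$ for $n\ge 2$. $A$ is $n$th Hom-power associative if $x^n=\alpha^{n-i-1}(x^i)\,\alpha^{i-1}(x^{n-i})$ for all $x\in A$ and $i\in\{1,\dots,n-1\}$; it is up to $n$th Hom-power associative if it is $k$th Hom-power associative for all $k\in\{2,\dots,n\}$. The Hom-associator is $as_A(x,y,z)=(xy)\alpha(z)-\alpha(x)(yz)$. $A$ is right Hom-alternative if $as_A(y,x,x)=0$ for all $x,y\in A$. $A$ is a non-commutative Hom-Jordan algebra if $as_A(x,y,x)=0$ (Hom-flexibility) and $as_A(x^2,\alpha(y),\alpha(x))=0$ for all $x,y\in A$, where $x^2=xx$. *)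

theory Defs
  imports Complex_Main
begin

text \<open>
  The ground field enters only through the scalar multiplication \<open>scale\<close>; the underlying
  vector space is the whole type \<open>'a\<close>. Bilinearity of \<open>\<mu>\<close> is linearity in each argument.
\<close>

locale hom_algebra = vector_space scale
  for scale :: "'k::field \<Rightarrow> 'a::ab_group_add \<Rightarrow> 'a" (infixr \<open>*s\<close> 75) +
  fixes \<mu> :: "'a \<Rightarrow> 'a \<Rightarrow> 'a"
    and \<alpha> :: "'a \<Rightarrow> 'a"
  assumes linear_mult_right: "Vector_Spaces.linear scale scale (\<lambda>y. \<mu> x y)"
    and linear_mult_left: "Vector_Spaces.linear scale scale (\<lambda>x. \<mu> x y)"
    and linear_twist: "Vector_Spaces.linear scale scale \<alpha>"

locale multiplicative_hom_algebra = hom_algebra +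
  assumes twist_mult: "\<alpha> (\<mu> x y) = \<mu> (\<alpha> x) (\<alpha> y)"

text \<open>Hom-powers start at exponent 1; the value at exponent 0 is left unspecified.\<close>

fun hom_power :: "('a \<Rightarrow> 'a \<Rightarrow> 'a) \<Rightarrow> ('a \<Rightarrow> 'a) \<Rightarrow> 'a \<Rightarrow> nat \<Rightarrow> 'a" where
  "hom_power \<mu> \<alpha> x (Suc 0) = x"
| "hom_power \<mu> \<alpha> x (Suc (Suc n)) = \<mu> (hom_power \<mu> \<alpha> x (Suc n)) ((\<alpha> ^^ n) x)"

definition nth_hom_power_associative ::
  "('a \<Rightarrow> 'a \<Rightarrow> 'a) \<Rightarrow> ('a \<Rightarrow> 'a) \<Rightarrow> nat \<Rightarrow> bool" where
  "nth_hom_power_associative \<mu> \<alpha> n \<longleftrightarrow>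
     (\<forall>x. \<forall>i\<in>{1..n - 1}.
        hom_power \<mu> \<alpha> x n =
          \<mu> ((\<alpha> ^^ (n - i - 1)) (hom_power \<mu> \<alpha> x i)) ((\<alpha> ^^ (i - 1)) (hom_power \<mu> \<alpha> x (n - i))))"

definition up_to_nth_hom_power_associative ::
  "('a \<Rightarrow> 'a \<Rightarrow> 'a) \<Rightarrow> ('a \<Rightarrow> 'a) \<Rightarrow> nat \<Rightarrow> bool" where
  "up_to_nth_hom_power_associative \<mu> \<alpha> n \<longleftrightarrow>
     (\<forall>k\<in>{2..n}. nth_hom_power_associative \<mu> \<alpha> k)"

definition hom_associator ::
  "('a::ab_group_add \<Rightarrow> 'a \<Rightarrow> 'a) \<Rightarrow> ('a \<Rightarrow> 'a) \<Rightarrow> 'a \<Rightarrow> 'a \<Rightarrow> 'a \<Rightarrow> 'a" where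
  "hom_associator \<mu> \<alpha> x y z = \<mu> (\<mu> x y) (\<alpha> z) - \<mu> (\<alpha> x) (\<mu> y z)"

definition right_hom_alternative ::
  "('a::ab_group_add \<Rightarrow> 'a \<Rightarrow> 'a) \<Rightarrow> ('a \<Rightarrow> 'a) \<Rightarrow> bool" where
  "right_hom_alternative \<mu> \<alpha> \<longleftrightarrow> (\<forall>x y. hom_associator \<mu> \<alpha> y x x = 0)"

definition hom_flexible ::
  "('a::ab_group_add \<Rightarrow> 'a \<Rightarrow> 'a) \<Rightarrow> ('a \<Rightarrow> 'a) \<Rightarrow> bool" where
  "hom_flexible \<mu> \<alpha> \<longleftrightarrow> (\<forall>x y. hom_associator \<mu> \<alpha> x y x = 0)"

definition noncommutative_hom_jordan ::
  "('a::ab_group_add \<Rightarrow> 'a \<Rightarrow> 'a) \<Rightarrow> ('a \<Rightarrow> 'a) \<Rightarrow> bool" where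
  "noncommutative_hom_jordan \<mu> \<alpha> \<longleftrightarrow>
     hom_flexible \<mu> \<alpha> \<and>
     (\<forall>x y. hom_associator \<mu> \<alpha> (\<mu> x x) (\<alpha> y) (\<alpha> x) = 0)"

end

theory Submission
  imports Defs
begin

text \<open>
  Write \<open>x\<^sup>2, x\<^sup>3, x\<^sup>4\<close> for the Hom-powers and \<open>as\<close> for the Hom-associator. Up to the fourth power,
  Hom-power associativity comes down to three vanishing Hom-associators. In degree three the only
  content is \<open>as(x, x, x) = 0\<close>, which follows from right Hom-alternativity as well as from
  Hom-flexibility. In degree four one needs \<open>x\<^sup>4 = \<alpha>(x\<^sup>2)\<alpha>(x\<^sup>2)\<close> and \<open>x\<^sup>4 = \<alpha>\<^sup>2(x)x\<^sup>3\<close>; by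
  multiplicativity and the degree three case, the associators
  \<open>as(x\<^sup>2, \<alpha>(x), \<alpha>(x)) = x\<^sup>4 - \<alpha>(x\<^sup>2)\<alpha>(x\<^sup>2)\<close> and \<open>as(\<alpha>(x), x\<^sup>2, \<alpha>(x)) = x\<^sup>4 - \<alpha>\<^sup>2(x)x\<^sup>3\<close>
  measure the failure of these equations.

  In a non-commutative Hom-Jordan algebra the first of them vanishes by the Hom-Jordan identity with
  \<open>y = x\<close>, the second by Hom-flexibility. In a right Hom-alternative algebra the first vanishes at
  once. For the second, linearization makes the associator skew in its last two arguments, so
  \<open>as(\<alpha>(x), x\<^sup>2, \<alpha>(x)) = - as(\<alpha>(x), \<alpha>(x), x\<^sup>2)\<close>. Given \<open>x\<^sup>4 = \<alpha>(x\<^sup>2)\<alpha>(x\<^sup>2)\<close>, both associators here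
  equal \<open>x\<^sup>4 - \<alpha>\<^sup>2(x)x\<^sup>3\<close>, so this difference is its own negative and is zero in
  characteristic \<open>0\<close>.
\<close>

lemma (in hom_algebra) mult_add_right: "\<mu> x (y + z) = \<mu> x y + \<mu> x z"
  using linear_mult_right[of x] by (simp add: Vector_Spaces.linear_iff)

lemma (in hom_algebra) mult_add_left: "\<mu> (x + y) z = \<mu> x z + \<mu> y z"
  using linear_mult_left[of z] by (simp add: Vector_Spaces.linear_iff)

lemma (in hom_algebra) twist_add: "\<alpha> (x + y) = \<alpha> x + \<alpha> y"
  using linear_twist by (simp add: Vector_Spaces.linear_iff)

text \<open>
  The right Hom-alternative law at \<open>b + c\<close>, minus the laws at \<open>b\<close> and \<open>c\<close>, leaves the two mixed terms.
\<close>

lemma (in hom_algebra) right_hom_alternative_linearized: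
  assumes "right_hom_alternative \<mu> \<alpha>"
  shows "hom_associator \<mu> \<alpha> a b c + hom_associator \<mu> \<alpha> a c b = 0"
proof -
  have van: "hom_associator \<mu> \<alpha> a u u = 0" for u
    using assms by (simp add: right_hom_alternative_def)
  have "hom_associator \<mu> \<alpha> a (b + c) (b + c) =
      hom_associator \<mu> \<alpha> a b b + hom_associator \<mu> \<alpha> a c c
        + (hom_associator \<mu> \<alpha> a b c + hom_associator \<mu> \<alpha> a c b)"
    by (simp add: hom_associator_def mult_add_left mult_add_right twist_add algebra_simps)
  then show ?thesis
    by (simp add: van)
qed

lemma up_to_fourth_hom_power_associativeI:
  assumes third: "\<And>x. \<mu> (\<mu> x x) (\<alpha> x) = \<mu> (\<alpha> x) (\<mu> x x)"
    and square: "\<And>x. \<mu> (\<mu> (\<mu> x x) (\<alpha> x)) (\<alpha> (\<alpha> x)) = \<mu> (\<alpha> (\<mu> x x)) (\<alpha> (\<mu> x x))"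
    and cube: "\<And>x. \<mu> (\<mu> (\<mu> x x) (\<alpha> x)) (\<alpha> (\<alpha> x)) = \<mu> (\<alpha> (\<alpha> x)) (\<mu> (\<mu> x x) (\<alpha> x))"
  shows "up_to_nth_hom_power_associative \<mu> \<alpha> 4"
proof -
  have range: "{2..4} = {2, 3, 4::nat}"
    by auto
  have powers: "hom_power \<mu> \<alpha> x 1 = x" "hom_power \<mu> \<alpha> x 2 = \<mu> x x"
    "hom_power \<mu> \<alpha> x 3 = \<mu> (\<mu> x x) (\<alpha> x)"
    "hom_power \<mu> \<alpha> x 4 = \<mu> (\<mu> (\<mu> x x) (\<alpha> x)) (\<alpha> (\<alpha> x))" for x
    by (simp_all add: eval_nat_numeral)
  have two: "nth_hom_power_associative \<mu> \<alpha> 2"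
    using powers by (simp add: nth_hom_power_associative_def)
  have three: "nth_hom_power_associative \<mu> \<alpha> 3"
    unfolding nth_hom_power_associative_def
  proof (intro allI ballI)
    fix x and i :: nat
    assume "i \<in> {1..3 - 1}"
    then consider "i = 1" | "i = 2" by force
    then show "hom_power \<mu> \<alpha> x 3 = \<mu> ((\<alpha> ^^ (3 - i - 1)) (hom_power \<mu> \<alpha> x i))
        ((\<alpha> ^^ (i - 1)) (hom_power \<mu> \<alpha> x (3 - i)))"
      using powers third[of x] by cases simp_all
  qed
  have "nth_hom_power_associative \<mu> \<alpha> 4"
    unfolding nth_hom_power_associative_def
  proof (intro allI ballI)
    fix x and i :: nat
    assume "i \<in> {1..4 - 1}"
    then consider "i = 1" | "i = 2" | "i = 3" by force
    then show "hom_power \<mu> \<alpha> x 4 = \<mu> ((\<alpha> ^^ (4 - i - 1)) (hom_power \<mu> \<alpha> x i))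
        ((\<alpha> ^^ (i - 1)) (hom_power \<mu> \<alpha> x (4 - i)))"
    proof cases
      case 1
      then show ?thesis using powers cube[of x] by (simp add: numeral_2_eq_2)
    next
      case 2
      then show ?thesis using powers square[of x] by simp
    next
      case 3
      then show ?thesis using powers by (simp add: numeral_2_eq_2)
    qed
  qed
  with two three show ?thesis
    by (simp add: up_to_nth_hom_power_associative_def range)
qed

theorem proposition4p4:
  fixes scale :: "'k::field_char_0 \<Rightarrow> 'a::ab_group_add \<Rightarrow> 'a"
    and \<mu> :: "'a \<Rightarrow> 'a \<Rightarrow> 'a"
    and \<alpha> :: "'a \<Rightarrow> 'a"
  assumes "multiplicative_hom_algebra scale \<mu> \<alpha>"
    and "right_hom_alternative \<mu> \<alpha> \<or> noncommutative_hom_jordan \<mu> \<alpha>"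
  shows "up_to_nth_hom_power_associative \<mu> \<alpha> 4"
proof -
  interpret multiplicative_hom_algebra scale \<mu> \<alpha> by fact
  have assoc_xxx: "hom_associator \<mu> \<alpha> x x x = 0" for x
    using assms(2)
    by (auto simp: right_hom_alternative_def noncommutative_hom_jordan_def hom_flexible_def)
  have third: "\<mu> (\<mu> x x) (\<alpha> x) = \<mu> (\<alpha> x) (\<mu> x x)" for x
    using assoc_xxx[of x] by (simp add: hom_associator_def)
  have "hom_associator \<mu> \<alpha> (\<mu> x x) (\<alpha> x) (\<alpha> x) = 0" for x
    using assms(2) by (auto simp: right_hom_alternative_def noncommutative_hom_jordan_def)
  then have square: "\<mu> (\<mu> (\<mu> x x) (\<alpha> x)) (\<alpha> (\<alpha> x)) = \<mu> (\<alpha> (\<mu> x x)) (\<alpha> (\<mu> x x))" for x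
    by (simp add: hom_associator_def twist_mult)
  have middle: "hom_associator \<mu> \<alpha> (\<alpha> x) (\<mu> x x) (\<alpha> x) =
      \<mu> (\<mu> (\<mu> x x) (\<alpha> x)) (\<alpha> (\<alpha> x)) - \<mu> (\<alpha> (\<alpha> x)) (\<mu> (\<mu> x x) (\<alpha> x))" for x
    by (simp add: hom_associator_def third)
  have assoc_middle: "hom_associator \<mu> \<alpha> (\<alpha> x) (\<mu> x x) (\<alpha> x) = 0" for x
    using assms(2)
  proof
    assume alt: "right_hom_alternative \<mu> \<alpha>"
    let ?d = "hom_associator \<mu> \<alpha> (\<alpha> x) (\<mu> x x) (\<alpha> x)"
    have "hom_associator \<mu> \<alpha> (\<alpha> x) (\<alpha> x) (\<mu> x x) = ?d"
      unfolding middle square by (simp add: hom_associator_def twist_mult third)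
    then have "?d + ?d = 0"
      using right_hom_alternative_linearized[OF alt, of "\<alpha> x" "\<mu> x x" "\<alpha> x"] by simp
    \<comment> \<open>In an additive group alone \<open>?d\<close> could have order two; the scalar \<open>2\<close> is nonzero in
      characteristic \<open>0\<close>.\<close>
    moreover have "scale 2 ?d = ?d + ?d"
      using scale_left_distrib[of 1 1 ?d] by simp
    ultimately show "?d = 0"
      by (metis scale_eq_0_iff zero_neq_numeral)
  next
    assume "noncommutative_hom_jordan \<mu> \<alpha>"
    then show "hom_associator \<mu> \<alpha> (\<alpha> x) (\<mu> x x) (\<alpha> x) = 0"
      by (simp add: noncommutative_hom_jordan_def hom_flexible_def)
  qed
  then have "\<mu> (\<mu> (\<mu> x x) (\<alpha> x)) (\<alpha> (\<alpha> x)) = \<mu> (\<alpha> (\<alpha> x)) (\<mu> (\<mu> x x) (\<alpha> x))" for x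
    using middle[of x] by simp
  with third square show ?thesis
    by (rule up_to_fourth_hom_power_associativeI)
qed

end
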